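(* Let $I=[\alpha,\beta]\subset[0,1]$ be an interval with $\alpha<\beta$ and $\alpha,\beta\in\mathbb{Q}$, and let $F(x,y)=\frac{1}{2x^2}+\frac{1}{2y^2}$. For real $\delta>0$ let $Q$ be the integer part of $\frac{1}{\sqrt{2\delta}}$. Then there is a constant $D_I$ depending only on $I$ such that, as $\delta\to 0^+$, $$M_{F,I,\delta}(\mathcal{F})=\frac{6}{\pi^2}Q^2\log Q+D_I Q^2+O_I(Q\log Q),$$ where the implied constant depends only on the interval $I$.
   Context: For a positive integer $Q$, $\mathcal F(Q)=\{p/q : 0\le p\le q\le Q,\ q\geq 1,\ \gcd(p,q)=1\}$ is the set of Farey fractions of order $Q$. For $I=[\alpha,\beta]\subset[0,1]$, write $\mathcal F(Q)\cap I=\{p_1/q_1<p_2/q_2<\dots<p_{N_I(Q)}/q_{N_I(Q)}\}$ with all fractions in lowest terms, so $N_I(Q)$ is the cardinality of this set. For $1\le j\le N_I(Q)-1$ put $x_j=q_j/Q$ and $y_j=q_{j+1}/Q$; then $(x_j,y_j)\in\Omega=\{(x,y)\in(0,1]^2 : x+y>1\}$. Given $\delta>0$, set $Q=\lfloor(2\delta)^{-1/2}\rfloor$. For a measurable function $F:\Omega\to\mathbb{R}$ the moment of $F$ is $$M_{F,I,\delta}(\mathcal F)=\frac{1}{|I|}\sum_{j=1}^{N_I(Q)-1}|F(x_j,y_j)|,\qquad |I|=\beta-\alpha.$$ *)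

theory Defs
  imports Complex_Main "HOL-Library.Landau_Symbols"
begin

definition farey :: "nat \<Rightarrow> rat set" where
  "farey Q = {of_nat p / of_nat q | p q :: nat. p \<le> q \<and> q \<le> Q \<and> 1 \<le> q \<and> coprime p q}"

definition farey_in :: "real \<Rightarrow> real \<Rightarrow> nat \<Rightarrow> rat set" where
  "farey_in \<alpha> \<beta> Q = {r \<in> farey Q. of_rat r \<in> {\<alpha>..\<beta>}}"

definition farey_count :: "real \<Rightarrow> real \<Rightarrow> nat \<Rightarrow> nat" where
  "farey_count \<alpha> \<beta> Q = card (farey_in \<alpha> \<beta> Q)"

(* The denominator in lowest terms of the j-th fraction in increasing order; j is counted
   from 1, and only values with 1 \<le> j \<le> farey_count \<alpha> \<beta> Q are meaningful. *)
definition farey_denom :: "real \<Rightarrow> real \<Rightarrow> nat \<Rightarrow> nat \<Rightarrow> int" where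
  "farey_denom \<alpha> \<beta> Q j = snd (quotient_of (sorted_list_of_set (farey_in \<alpha> \<beta> Q) ! (j - 1)))"

definition farey_order :: "real \<Rightarrow> nat" where
  "farey_order \<delta> = nat \<lfloor>1 / sqrt (2 * \<delta>)\<rfloor>"

(* F is a total function here, but it is only evaluated at the points (q_j / Q, q_{j+1} / Q),
   which lie in {(x, y). 0 < x \<and> x \<le> 1 \<and> 0 < y \<and> y \<le> 1 \<and> x + y > 1}.
   The sum is empty when farey_count is 0 or 1. *)
definition moment :: "(real \<times> real \<Rightarrow> real) \<Rightarrow> real \<Rightarrow> real \<Rightarrow> real \<Rightarrow> real" where
  "moment F \<alpha> \<beta> \<delta> =
     (let Q = farey_order \<delta> in
        1 / (\<beta> - \<alpha>) *
          (\<Sum>j = 1..farey_count \<alpha> \<beta> Q - 1.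
             \<bar>F (of_int (farey_denom \<alpha> \<beta> Q j) / of_nat Q,
                of_int (farey_denom \<alpha> \<beta> Q (j + 1)) / of_nat Q)\<bar>))"

end

theory Submission
  imports Defs "HOL-Analysis.Gamma_Function" "HOL-Computational_Algebra.Squarefree"
    "HOL-Real_Asymp.Real_Asymp"
begin

text \<open>
  Adding the two terms of \<open>F\<close> over consecutive pairs counts every interior fraction twice, so the
  moment is \<open>Q\<^sup>2/\<bar>I\<bar>\<close> times the sum of \<open>1/q\<^sup>2\<close> over the fractions in \<open>I\<close>, less half the contribution of
  the two extreme ones. For large \<open>Q\<close> these are the rational endpoints, so this correction is
  constant. Moebius inversion turns the remaining sum into
  \<open>\<Sum>d\<le>Q. \<mu>(d)/d\<^sup>2 * A(Q div d)\<close> with \<open>A(M) = \<Sum>e\<le>M. w(e)/e\<^sup>2\<close>, where \<open>w(e) = \<bar>I\<bar> e + O(1)\<close> counts the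
  integers in \<open>e I\<close>. Hence \<open>A(M) = \<bar>I\<bar> ln M + const + O(1/M)\<close>, and summing over \<open>d\<close> with
  \<open>\<Sum>d. \<mu>(d)/d\<^sup>2 = 6/\<pi>\<^sup>2\<close> gives the claim.
\<close>

section \<open>The Moebius function and its divisor sums\<close>

definition moebius_mu :: "nat \<Rightarrow> real" where
  "moebius_mu n = (if squarefree n then (-1) ^ card (prime_factors n) else 0)"

lemma abs_moebius_mu_le: "\<bar>moebius_mu n\<bar> \<le> 1"
  by (simp add: moebius_mu_def power_abs)

text \<open>A new prime factor leaves squarefreeness unchanged and raises the number of prime
  factors by one.\<close>

lemma moebius_prime_mult:
  assumes "prime p" "\<not> p dvd d"
  shows "moebius_mu (p * d) = - moebius_mu d"
proof -
  have cop: "coprime p d" using assms by (simp add: prime_imp_coprime)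
  have "d \<noteq> 0" using assms by (metis dvd_0_right)
  then have pf: "prime_factors (p * d) = insert p (prime_factors d)"
    using assms(1) by (simp add: prime_factors_product prime_prime_factors prime_gt_0_nat)
  have "squarefree (p * d) \<longleftrightarrow> squarefree d"
    using cop assms(1) squarefree_mult_coprime[of p d] squarefree_prime[of p]
      squarefree_mono[of d "p * d"] by auto
  moreover have "p \<notin> prime_factors d" using assms by auto
  ultimately show ?thesis by (simp add: moebius_mu_def pf)
qed

text \<open>For n > 1 fix a prime p dividing n. Multiplication by p matches the squarefree divisors
  prime to p with those divisible by p, and matched terms cancel.\<close>

lemma sum_moebius_dvd:
  assumes "n > 0"
  shows "(\<Sum>d | d dvd n. moebius_mu d) = (if n = 1 then 1 else 0)"
proof (cases "n = 1")
  case True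
  then show ?thesis by (simp add: moebius_mu_def)
next
  case False
  then obtain p where p: "prime p" "p dvd n" using prime_factor_nat by blast
  define A where "A = {d. d dvd n \<and> squarefree d \<and> \<not> p dvd d}"
  have fin: "finite {d. d dvd n}" using assms by simp
  then have finA: "finite A" by (rule rev_finite_subset) (auto simp: A_def)
  have B: "{d. d dvd n \<and> squarefree d \<and> p dvd d} = (\<lambda>d. p * d) ` A"
  proof (intro equalityI subsetI)
    fix d assume "d \<in> {d. d dvd n \<and> squarefree d \<and> p dvd d}"
    then obtain k where k: "d = p * k" "d dvd n" "squarefree d" by (auto elim: dvdE)
    have "\<not> p dvd k"
    proof
      assume "p dvd k"
      then have "p\<^sup>2 dvd d" using k(1) by (simp add: power2_eq_square)
      then have "is_unit p" using k(3) by (simp add: squarefree_def)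
      then show False using p(1) by auto
    qed
    moreover have "k dvd d" using k(1) by simp
    ultimately have "k \<in> A" using k squarefree_mono[of k d] dvd_trans[of k d n] by (simp add: A_def)
    then show "d \<in> (\<lambda>d. p * d) ` A" using k(1) by blast
  next
    fix d assume "d \<in> (\<lambda>d. p * d) ` A"
    then obtain k where k: "d = p * k" "k dvd n" "squarefree k" "\<not> p dvd k" by (auto simp: A_def)
    have cop: "coprime p k" using p(1) k(4) by (simp add: prime_imp_coprime)
    show "d \<in> {d. d dvd n \<and> squarefree d \<and> p dvd d}"
      using divides_mult[OF p(2) k(2) cop] squarefree_mult_coprime[OF cop squarefree_prime[OF p(1)] k(3)]
      by (simp add: k(1))
  qed
  have inj: "inj_on (\<lambda>d. p * d) A" using p(1) by (auto simp: inj_on_def)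
  have union: "A \<union> (\<lambda>d. p * d) ` A = {d. d dvd n \<and> squarefree d}"
    unfolding B[symmetric] by (auto simp: A_def)
  have "(\<Sum>d | d dvd n. moebius_mu d) = (\<Sum>d \<in> A \<union> (\<lambda>d. p * d) ` A. moebius_mu d)"
    unfolding union by (rule sum.mono_neutral_right[OF fin]) (auto simp: moebius_mu_def)
  also have "\<dots> = (\<Sum>d\<in>A. moebius_mu d) + (\<Sum>d\<in>(\<lambda>d. p * d) ` A. moebius_mu d)"
    by (rule sum.union_disjoint) (use finA in \<open>auto simp: A_def\<close>)
  also have "(\<Sum>d\<in>(\<lambda>d. p * d) ` A. moebius_mu d) = (\<Sum>d\<in>A. moebius_mu (p * d))"
    by (simp add: sum.reindex[OF inj])
  also have "\<dots> = (\<Sum>d\<in>A. - moebius_mu d)"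
    by (rule sum.cong) (use p(1) moebius_prime_mult in \<open>auto simp: A_def\<close>)
  finally show ?thesis using False by (simp add: sum_negf)
qed

text \<open>Writing n = d * e, both sides run over all pairs with d * e \<le> N. This is how
  Dirichlet convolutions are summed below.\<close>

lemma sum_dvd_eq_sum_div:
  fixes h :: "nat \<Rightarrow> nat \<Rightarrow> 'a::comm_monoid_add"
  shows "(\<Sum>n=1..N. \<Sum>d | d dvd n. h d (n div d)) = (\<Sum>d=1..N. \<Sum>e=1..N div d. h d e)"
proof -
  have factor_le: "b \<le> N" if "b * k \<le> N" "0 < k" for b k
    by (rule order_trans[OF _ that(1)]) (use that(2) in simp)
  have "(\<Sum>n=1..N. \<Sum>d | d dvd n. h d (n div d)) =
      (\<Sum>(n,d)\<in>(SIGMA n:{1..N}. {d. d dvd n}). h d (n div d))"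
    by (rule sum.Sigma) auto
  also have "\<dots> = (\<Sum>(d,e)\<in>(SIGMA d:{1..N}. {1..N div d}). h d e)"
    by (rule sum.reindex_bij_witness[where i = "\<lambda>(d,e). (d * e, d)" and j = "\<lambda>(n,d). (d, n div d)"])
      (auto elim!: dvdE simp: div_le_mono Suc_le_eq less_eq_div_iff_mult_less_eq mult.commute, erule (1) factor_le)
  also have "\<dots> = (\<Sum>d=1..N. \<Sum>e=1..N div d. h d e)"
    by (rule sum.Sigma[symmetric]) auto
  finally show ?thesis .
qed

section \<open>Convergence of series with explicit tail bounds\<close>

text \<open>Blocks of the series are dominated by the telescoping differences t N - t M, so the
  partial sums are Cauchy, and letting M tend to infinity bounds the tail. The bound concerns only
  the terms from the second on, so the first term is arbitrary.\<close>

lemma telescoping_tail_bound: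
  fixes a t :: "nat \<Rightarrow> real"
  assumes bound: "\<And>n. n \<ge> 1 \<Longrightarrow> \<bar>a (Suc n)\<bar> \<le> t n - t (Suc n)" and lim: "t \<longlonglongrightarrow> 0"
  obtains L where "\<And>N. N \<ge> 1 \<Longrightarrow> \<bar>(\<Sum>n=1..N. a n) - L\<bar> \<le> t N"
proof -
  define s where "s = (\<lambda>N. \<Sum>n=1..N. a n)"
  have diff: "\<bar>s M - s N\<bar> \<le> t N - t M" if "1 \<le> N" "N \<le> M" for M N
    using that(2)
  proof (induction M rule: dec_induct)
    case (step M)
    have "s (Suc M) = s M + a (Suc M)" by (simp add: s_def)
    then show ?case using step bound[of M] that(1) by linarith
  qed simp
  \<comment> \<open>The block bound makes \<open>t\<close> nonincreasing from 1 on, and its limit is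
    0.\<close>
  have tnn: "t N \<ge> 0" if "1 \<le> N" for N
  proof (rule LIMSEQ_le_const2[OF lim])
    show "\<exists>n. \<forall>m\<ge>n. t m \<le> t N" using diff[OF that] by (intro exI[of _ N]) fastforce
  qed
  have "Cauchy s"
  proof (rule metric_CauchyI)
    fix e :: real assume "e > 0"
    then obtain n0 where n0: "\<And>n. n \<ge> n0 \<Longrightarrow> \<bar>t n\<bar> < e"
      using LIMSEQ_D[OF lim] by (metis diff_zero real_norm_def)
    have *: "\<bar>s m - s n\<bar> < e" if "n \<ge> max 1 n0" "m \<ge> n" for m n
      using diff[of n m] n0[of n] tnn[of m] that by auto
    show "\<exists>M. \<forall>m\<ge>M. \<forall>n\<ge>M. dist (s m) (s n) < e"
    proof (intro exI allI impI)
      fix m n assume "m \<ge> max 1 n0" "n \<ge> max 1 n0"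
      then show "dist (s m) (s n) < e" using *[of n m] *[of m n] by (cases "m \<ge> n") (auto simp: dist_real_def)
    qed
  qed
  then obtain L where L: "s \<longlonglongrightarrow> L" using Cauchy_convergent convergentD by blast
  have "\<bar>s N - L\<bar> \<le> t N" if "N \<ge> 1" for N
  proof -
    have "(\<lambda>M. \<bar>s N - s M\<bar>) \<longlonglongrightarrow> \<bar>s N - L\<bar>" by (intro tendsto_intros L)
    moreover have "\<bar>s N - s M\<bar> \<le> t N" if "M \<ge> N" for M
      using diff[OF \<open>N \<ge> 1\<close> that] tnn[of M] \<open>N \<ge> 1\<close> that by auto
    ultimately show ?thesis by (intro LIMSEQ_le_const2) auto
  qed
  then show ?thesis using that unfolding s_def by blast
qed

lemma inverse_square_le_telescope:
  "n \<ge> 1 \<Longrightarrow> 1 / (real (Suc n))\<^sup>2 \<le> 1 / real n - 1 / real (Suc n)"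
  by (simp add: divide_simps power2_eq_square)

lemma ln_add_one_minus_ln_le:
  fixes x :: real
  assumes "x > 0"
  shows "ln (x + 1) - ln x \<le> 1 / x"
proof -
  have "ln ((x + 1) / x) \<le> (x + 1) / x - 1" using assms by (intro ln_le_minus_one) auto
  moreover have "(x + 1) / x - 1 = 1 / x" using assms by (simp add: field_simps)
  ultimately show ?thesis using ln_divide_pos[of "x + 1" x] assms by simp
qed

lemma ln_add_one_minus_ln_ge:
  fixes x :: real
  assumes "x > 0"
  shows "ln (x + 1) - ln x \<ge> 1 / (x + 1)"
proof -
  have "ln (x / (x + 1)) \<le> x / (x + 1) - 1" using assms by (intro ln_le_minus_one) auto
  moreover have "x / (x + 1) - 1 = - (1 / (x + 1))" using assms by (simp add: field_simps)
  ultimately show ?thesis using ln_divide_pos[of x "x + 1"] assms by simp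
qed

lemma bounded_over_squares_tail:
  fixes g :: "nat \<Rightarrow> real"
  assumes "\<And>n. n \<ge> 1 \<Longrightarrow> \<bar>g n\<bar> \<le> 1"
  obtains L where "\<And>N. N \<ge> 1 \<Longrightarrow> \<bar>(\<Sum>n=1..N. g n / (real n)\<^sup>2) - L\<bar> \<le> 1 / N"
proof (rule telescoping_tail_bound)
  fix n :: nat assume "n \<ge> 1"
  have "\<bar>g (Suc n) / (real (Suc n))\<^sup>2\<bar> \<le> 1 / (real (Suc n))\<^sup>2"
    using assms[of "Suc n"] by (simp add: divide_right_mono del: of_nat_Suc)
  also have "\<dots> \<le> 1 / real n - 1 / real (Suc n)" by (rule inverse_square_le_telescope) fact
  finally show "\<bar>g (Suc n) / (real (Suc n))\<^sup>2\<bar> \<le> 1 / real n - 1 / real (Suc n)" .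
next
  show "(\<lambda>n. 1 / real n) \<longlonglongrightarrow> 0" by (rule lim_1_over_n)
qed (rule that)

text \<open>The integral of ln u / u^2 from N to infinity is (ln N + 1) / N. Using 2 in place of 1
  gives the slack with which the telescoping inequality already holds at n = 1.\<close>

lemma bounded_ln_over_squares_tail:
  fixes g :: "nat \<Rightarrow> real"
  assumes "\<And>n. n \<ge> 1 \<Longrightarrow> \<bar>g n\<bar> \<le> 1"
  obtains L where "\<And>N. N \<ge> 1 \<Longrightarrow> \<bar>(\<Sum>n=1..N. g n * ln n / (real n)\<^sup>2) - L\<bar> \<le> (ln N + 2) / N"
proof (rule telescoping_tail_bound)
  fix m :: nat assume m: "m \<ge> 1"
  define x where "x = real m"
  have x: "x \<ge> 1" and Suc_x: "real (Suc m) = x + 1" using m by (auto simp: x_def)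
  \<comment> \<open>With ln x replaced by this lower bound, only one logarithm remains, and the
    slack in the inequality is an explicit sum of two terms that are nonnegative for x \<ge>
    1.\<close>
  have ln: "ln x \<ge> ln (x + 1) - 1 / x" using ln_add_one_minus_ln_le[of x] x by simp
  have "\<bar>g (Suc m) * ln (Suc m) / (real (Suc m))\<^sup>2\<bar> \<le> ln (x + 1) / (x + 1)\<^sup>2"
    using assms[of "Suc m"] x unfolding Suc_x
    by (auto simp: abs_mult intro!: divide_right_mono mult_left_le_one_le)
  also have "\<dots> \<le> (ln (x + 1) - 1 / x + 2) / x - (ln (x + 1) + 2) / (x + 1)"
  proof -
    have l0: "ln (x + 1) \<ge> 0" using x by simp
    have "(ln (x + 1) - 1 / x + 2) / x - (ln (x + 1) + 2) / (x + 1) - ln (x + 1) / (x + 1)\<^sup>2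
        = ln (x + 1) / (x * (x + 1)\<^sup>2) + (x - 1) / (x\<^sup>2 * (x + 1))"
      using x by (simp add: divide_simps power2_eq_square) (simp add: algebra_simps)
    also have "\<dots> \<ge> 0" using x l0 by (intro add_nonneg_nonneg divide_nonneg_nonneg) auto
    finally show ?thesis by simp
  qed
  also have "\<dots> \<le> (ln x + 2) / x - (ln (x + 1) + 2) / (x + 1)"
    using ln x by (simp add: divide_right_mono)
  finally show "\<bar>g (Suc m) * ln (Suc m) / (real (Suc m))\<^sup>2\<bar>
      \<le> (ln (real m) + 2) / real m - (ln (real (Suc m)) + 2) / real (Suc m)"
    unfolding Suc_x by (simp add: x_def)
next
  have "(\<lambda>n. ln (real n) / real n + 2 * (1 / real n)) \<longlonglongrightarrow> 0 + 2 * 0"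
    by (intro tendsto_intros lim_ln_over_n lim_1_over_n)
  then show "(\<lambda>n. (ln (real n) + 2) / real n) \<longlonglongrightarrow> 0" by (simp add: add_divide_distrib)
qed (rule that)

text \<open>Since ln (n + 1) - ln n lies between 1 / (n + 1) and 1 / n, the correction terms are
  bounded by differences of 1 / n. The limit is the Euler-Mascheroni constant.\<close>

lemma harmonic_minus_ln_tail:
  obtains L where "\<And>N. N \<ge> 1 \<Longrightarrow> \<bar>(\<Sum>n=1..N. 1 / real n) - ln N - L\<bar> \<le> 1 / N"
proof -
  \<comment> \<open>At n = 1 the convention \<open>ln 0 = 0\<close> gives \<open>a 1 = 1\<close>, so
    the partial sums are exactly the harmonic sums minus ln N.\<close>
  define a where "a n = 1 / real n - (ln (real n) - ln (real (n - 1)))" for n :: nat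
  have "\<bar>a (Suc n)\<bar> \<le> 1 / real n - 1 / real (Suc n)" if n: "n \<ge> 1" for n
  proof -
    define x where "x = real n"
    have x: "x > 0" using n by (simp add: x_def)
    have "a (Suc n) = 1 / (x + 1) - (ln (x + 1) - ln x)"
      by (simp add: a_def x_def add.commute)
    then show ?thesis using ln_add_one_minus_ln_le[OF x] ln_add_one_minus_ln_ge[OF x]
      by (simp add: x_def add.commute)
  qed
  then obtain L where L: "\<And>N. N \<ge> 1 \<Longrightarrow> \<bar>(\<Sum>n=1..N. a n) - L\<bar> \<le> 1 / N"
    using telescoping_tail_bound[OF _ lim_1_over_n, of a] by metis
  have "(\<Sum>n=1..N. a n) = (\<Sum>n=1..N. 1 / real n) - ln N" for N
    by (induction N) (auto simp: a_def)
  then show ?thesis using L by (intro that) simp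
qed

lemma harmonic_le:
  "N \<ge> 1 \<Longrightarrow> (\<Sum>n=1..N. 1 / real n) \<le> 1 + ln N"
proof (induction N rule: dec_induct)
  case (step n)
  define x where "x = real n"
  have x: "x > 0" using step by (simp add: x_def)
  show ?case using ln_add_one_minus_ln_ge[OF x] step.IH by (simp add: x_def add.commute)
qed simp

section \<open>Errors at integer quotients, weighted by the Moebius function\<close>

text \<open>As the quotient M = N div d is at least 1, N < d * (M + 1) \<le> 2 * d * M. This
  converts errors O(1/M) into O(d/N), which can be summed over d.\<close>

lemma inverse_div_le:
  fixes d N :: nat
  assumes "1 \<le> d" "d \<le> N"
  shows "1 / real (N div d) \<le> 2 * real d / real N"
proof -
  have "N div d \<ge> 1" using assms by (simp add: Suc_le_eq div_greater_zero_iff)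
  moreover have "N < d * (N div d + 1)"
    using assms dividend_less_times_div[of d N] by simp
  moreover have "d \<le> d * (N div d)" using \<open>N div d \<ge> 1\<close> by simp
  ultimately have "N \<le> 2 * d * (N div d)" unfolding distrib_left by linarith
  then have "real N \<le> 2 * real d * real (N div d)"
    by (metis of_nat_le_iff of_nat_mult of_nat_numeral)
  then show ?thesis using assms \<open>N div d \<ge> 1\<close> by (simp add: field_simps)
qed

text \<open>The real quotient N / d lies between M = N div d and M + 1, and ln grows by at most 1 /
  M there.\<close>

lemma ln_div_nat_bounds:
  fixes d N :: nat
  assumes "1 \<le> d" "d \<le> N"
  shows "\<bar>ln (real (N div d)) - (ln N - ln d)\<bar> \<le> 1 / real (N div d)"
proof -
  define M where "M = real (N div d)"
  have M: "M \<ge> 1" using assms by (simp add: M_def Suc_le_eq div_greater_zero_iff)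
  have "real (d * (N div d)) \<le> real N" by (simp only: of_nat_le_iff) simp
  then have lo: "M \<le> N / d" using assms by (simp add: M_def field_simps)
  have "N < d * (N div d + 1)" using assms dividend_less_times_div[of d N] by simp
  then have "real N < real (d * (N div d + 1))" by (simp only: of_nat_less_iff)
  then have hi: "N / d \<le> M + 1" using assms by (simp add: M_def field_simps)
  have eq: "ln (N / d) = ln N - ln d" using assms by (intro ln_divide_pos) auto
  have "ln M \<le> ln (N / d)" using lo M by simp
  moreover have "ln (N / d) \<le> ln (M + 1)" using hi lo M by simp
  moreover have "ln (M + 1) - ln M \<le> 1 / M" using M by (intro ln_add_one_minus_ln_le) auto
  ultimately show ?thesis by (simp add: eq M_def)
qed

text \<open>The weight 1 / d^2 turns an error of size d / N into 1 / (d * N), and the harmonic sum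
  over d then produces the logarithm of the final error term.\<close>

lemma moebius_weighted_error:
  fixes r :: "nat \<Rightarrow> real"
  assumes "N \<ge> 1" and "C \<ge> 0"
    and r: "\<And>d. 1 \<le> d \<Longrightarrow> d \<le> N \<Longrightarrow> \<bar>r d\<bar> \<le> C * real d / real N"
  shows "\<bar>\<Sum>d=1..N. moebius_mu d / (real d)\<^sup>2 * r d\<bar> \<le> C * (1 + ln N) / N"
proof -
  have "\<bar>\<Sum>d=1..N. moebius_mu d / (real d)\<^sup>2 * r d\<bar> \<le> (\<Sum>d=1..N. \<bar>moebius_mu d / (real d)\<^sup>2 * r d\<bar>)"
    by (rule sum_abs)
  also have "\<dots> \<le> (\<Sum>d=1..N. C / N * (1 / real d))"
  proof (rule sum_mono)
    fix d assume d: "d \<in> {1..N}"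
    have "\<bar>moebius_mu d / (real d)\<^sup>2 * r d\<bar> \<le> 1 / (real d)\<^sup>2 * (C * real d / real N)"
      unfolding abs_mult using d r[of d] abs_moebius_mu_le[of d]
      by (intro mult_mono) (auto simp: divide_right_mono)
    also have "\<dots> = C / N * (1 / real d)" using d by (simp add: power2_eq_square)
    finally show "\<bar>moebius_mu d / (real d)\<^sup>2 * r d\<bar> \<le> C / N * (1 / real d)" .
  qed
  also have "\<dots> = C / N * (\<Sum>d=1..N. 1 / real d)" by (rule sum_distrib_left[symmetric])
  also have "\<dots> \<le> C / N * (1 + ln N)"
    by (rule mult_left_mono[OF harmonic_le]) (use assms in auto)
  finally show ?thesis by simp
qed

lemma tendsto_one_plus_ln_over_n: "(\<lambda>N. C * (1 + ln (real N)) / real N) \<longlonglongrightarrow> 0"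
proof -
  have "(\<lambda>n. C * (1 / real n + ln (real n) / real n)) \<longlonglongrightarrow> C * (0 + 0)"
    by (intro tendsto_intros lim_ln_over_n lim_1_over_n)
  then show ?thesis by (simp add: add_divide_distrib[symmetric])
qed

section \<open>The series of mu(d) / d^2\<close>

text \<open>The tail bound holds for some limit L. To identify L, the Moebius sum is convolved with
  the partial sums of the series of 1 / n^2, whose value is Z = pi^2 / 6; this gives exactly 1,
  whence Z * L = 1.\<close>

lemma sum_moebius_over_squares_tail:
  assumes "N \<ge> 1"
  shows "\<bar>(\<Sum>d=1..N. moebius_mu d / (real d)\<^sup>2) - 6 / pi\<^sup>2\<bar> \<le> 1 / N"
proof -
  obtain L where L: "\<And>N. N \<ge> 1 \<Longrightarrow> \<bar>(\<Sum>d=1..N. moebius_mu d / (real d)\<^sup>2) - L\<bar> \<le> 1 / N"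
    using bounded_over_squares_tail[of moebius_mu] abs_moebius_mu_le by blast
  obtain Z where Z: "\<And>N. N \<ge> 1 \<Longrightarrow> \<bar>(\<Sum>n=1..N. 1 / (real n)\<^sup>2) - Z\<bar> \<le> 1 / N"
    using bounded_over_squares_tail[of "\<lambda>_. 1"] by auto
  have lim0: "f \<longlonglongrightarrow> l" if "\<And>N. N \<ge> 1 \<Longrightarrow> \<bar>f N - l\<bar> \<le> t N" "t \<longlonglongrightarrow> 0" for f t :: "nat \<Rightarrow> real" and l
    by (rule Lim_transform_eventually[OF _ ], rule Lim_null_comparison[THEN LIM_zero_cancel])
      (use that in \<open>auto intro!: eventually_sequentiallyI[of 1]\<close>)
  have limZ: "(\<lambda>N. \<Sum>n=1..N. 1 / (real n)\<^sup>2) \<longlonglongrightarrow> Z" by (rule lim0[OF Z lim_1_over_n])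
  have "(\<lambda>n. \<Sum>k<n. 1 / (real k + 1)\<^sup>2) \<longlonglongrightarrow> pi\<^sup>2 / 6"
    using inverse_squares_sums by (simp add: sums_def add.commute)
  moreover have "(\<Sum>k<n. 1 / (real k + 1)\<^sup>2) = (\<Sum>k=1..n. 1 / (real k)\<^sup>2)" for n
    by (induction n) (auto simp: add.commute)
  ultimately have Z_eq: "Z = pi\<^sup>2 / 6" using LIMSEQ_unique[OF limZ] by simp
  \<comment> \<open>Grouping the terms by n = d * e leaves the divisor sum of mu over n^2, which
    vanishes except at n = 1.\<close>
  have one: "1 = (\<Sum>d=1..N. moebius_mu d / (real d)\<^sup>2 * (\<Sum>e=1..N div d. 1 / (real e)\<^sup>2))" if "N \<ge> 1" for N
  proof -
    have "(\<Sum>d=1..N. moebius_mu d / (real d)\<^sup>2 * (\<Sum>e=1..N div d. 1 / (real e)\<^sup>2)) =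
        (\<Sum>n=1..N. \<Sum>d | d dvd n. moebius_mu d / (real d)\<^sup>2 * (1 / (real (n div d))\<^sup>2))"
      unfolding sum_distrib_left by (rule sum_dvd_eq_sum_div[symmetric])
    also have "\<dots> = (\<Sum>n=1..N. (\<Sum>d | d dvd n. moebius_mu d) / (real n)\<^sup>2)"
      unfolding sum_divide_distrib
      by (intro sum.cong refl) (auto elim!: dvdE simp: power_mult_distrib)
    also have "\<dots> = (\<Sum>n=1..N. if n = 1 then 1 else 0)"
      by (rule sum.cong[OF refl]) (simp add: sum_moebius_dvd)
    also have "\<dots> = 1" using that by simp
    finally show ?thesis by simp
  qed
  have "\<bar>Z * (\<Sum>d=1..N. moebius_mu d / (real d)\<^sup>2) - 1\<bar> \<le> 2 * (1 + ln N) / N" if N: "N \<ge> 1" for N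
  proof -
    \<comment> \<open>The error of replacing each inner partial sum by Z is at most 1 / (N div d),
      hence 2 * d / N.\<close>
    have "Z * (\<Sum>d=1..N. moebius_mu d / (real d)\<^sup>2) - 1 =
       (\<Sum>d=1..N. moebius_mu d / (real d)\<^sup>2 * (Z - (\<Sum>e=1..N div d. 1 / (real e)\<^sup>2)))"
      by (subst one[OF N]) (simp add: sum_distrib_left sum_subtractf[symmetric] algebra_simps)
    also have "\<bar>\<dots>\<bar> \<le> 2 * (1 + ln N) / N"
    proof (rule moebius_weighted_error[OF N])
      fix d assume d: "1 \<le> d" "d \<le> N"
      have "\<bar>Z - (\<Sum>e=1..N div d. 1 / (real e)\<^sup>2)\<bar> \<le> 1 / real (N div d)"
        using Z[of "N div d"] d by (simp add: abs_minus_commute Suc_le_eq div_greater_zero_iff)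
      then show "\<bar>Z - (\<Sum>e=1..N div d. 1 / (real e)\<^sup>2)\<bar> \<le> 2 * real d / real N"
        using inverse_div_le[OF d] by linarith
    qed simp
    finally show ?thesis .
  qed
  then have "(\<lambda>N. Z * (\<Sum>d=1..N. moebius_mu d / (real d)\<^sup>2)) \<longlonglongrightarrow> 1"
    by (rule lim0[OF _ tendsto_one_plus_ln_over_n])
  moreover have "(\<lambda>N. Z * (\<Sum>d=1..N. moebius_mu d / (real d)\<^sup>2)) \<longlonglongrightarrow> Z * L"
    by (intro tendsto_intros lim0[OF L lim_1_over_n])
  ultimately have "Z * L = 1" using LIMSEQ_unique by blast
  then have "L = 6 / pi\<^sup>2" by (simp add: Z_eq field_simps)
  then show ?thesis using L[OF assms] by simp
qed

section \<open>Asymptotics of the Moebius convolution\<close>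

text \<open>Splitting w(e) into c * e and a bounded remainder gives A(M) = c * ln M + k + O(1/M). At
  M = N div d the logarithm is ln N - ln d up to O(1/M): the ln N yields the main term, while ln d
  contributes -c times the series of mu(d) * ln d / d^2 to the constant.\<close>

lemma moebius_convolution_asymptotic:
  fixes w :: "nat \<Rightarrow> real"
  assumes w: "\<And>e. e \<ge> 1 \<Longrightarrow> \<bar>w e - c * real e\<bar> \<le> 1"
  obtains K C where "\<And>N. N \<ge> 1 \<Longrightarrow>
    \<bar>(\<Sum>n=1..N. (\<Sum>d | d dvd n. moebius_mu d * w (n div d)) / (real n)\<^sup>2)
       - (6 / pi\<^sup>2 * c * ln N + K)\<bar> \<le> C * (1 + ln N) / N"
proof -
  obtain G where G: "\<And>N. N \<ge> 1 \<Longrightarrow> \<bar>(\<Sum>n=1..N. (w n - c * real n) / (real n)\<^sup>2) - G\<bar> \<le> 1 / N"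
    using bounded_over_squares_tail[of "\<lambda>n. w n - c * real n"] w by blast
  obtain \<gamma> where \<gamma>: "\<And>N. N \<ge> 1 \<Longrightarrow> \<bar>(\<Sum>n=1..N. 1 / real n) - ln N - \<gamma>\<bar> \<le> 1 / N"
    using harmonic_minus_ln_tail by blast
  obtain L where L: "\<And>N. N \<ge> 1 \<Longrightarrow> \<bar>(\<Sum>d=1..N. moebius_mu d * ln d / (real d)\<^sup>2) - L\<bar> \<le> (ln N + 2) / N"
    using bounded_ln_over_squares_tail[of moebius_mu] abs_moebius_mu_le by blast
  define k where "k = c * \<gamma> + G"
  define A where "A M = (\<Sum>e=1..M. w e / (real e)\<^sup>2)" for M
  \<comment> \<open>Two errors of size \<bar>c\<bar> / M, from the harmonic sum and from ln M, and
    one of size 1 / M from the remainder; the outer 2 comes from 1 / M \<le> 2 * d / N.\<close>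
  define C where "C = 2 * (2 * \<bar>c\<bar> + 1)"
  have A: "\<bar>A (N div d) - (c * (ln N - ln d) + k)\<bar> \<le> C * real d / real N"
    if d: "1 \<le> d" "d \<le> N" for N d
  proof -
    define M where "M = N div d"
    have M: "M \<ge> 1" using d by (simp add: M_def Suc_le_eq div_greater_zero_iff)
    define x where "x = (\<Sum>n=1..M. 1 / real n) - ln M - \<gamma>"
    define y where "y = ln M - (ln N - ln d)"
    define z where "z = (\<Sum>n=1..M. (w n - c * real n) / (real n)\<^sup>2) - G"
    have "A M = c * (\<Sum>n=1..M. 1 / real n) + (\<Sum>n=1..M. (w n - c * real n) / (real n)\<^sup>2)"
      unfolding A_def sum_distrib_left sum.distrib[symmetric]
      by (rule sum.cong) (auto simp: field_simps power2_eq_square)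
    then have "A M - (c * (ln N - ln d) + k) = c * x + c * y + z"
      by (simp add: x_def y_def z_def k_def algebra_simps)
    also have "\<bar>\<dots>\<bar> \<le> \<bar>c\<bar> * \<bar>x\<bar> + \<bar>c\<bar> * \<bar>y\<bar> + \<bar>z\<bar>"
      unfolding abs_mult[symmetric] by linarith
    also have "\<dots> \<le> \<bar>c\<bar> * (1 / M) + \<bar>c\<bar> * (1 / M) + 1 / M"
      using \<gamma>[OF M] G[OF M] ln_div_nat_bounds[OF d]
      unfolding x_def y_def z_def M_def by (intro add_mono mult_left_mono) auto
    also have "\<dots> = (2 * \<bar>c\<bar> + 1) * (1 / real (N div d))" by (simp add: M_def algebra_simps)
    also have "\<dots> \<le> (2 * \<bar>c\<bar> + 1) * (2 * real d / real N)"
      by (rule mult_left_mono[OF inverse_div_le[OF d]]) simp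
    also have "\<dots> = C * real d / real N" by (simp add: C_def)
    finally show ?thesis by (simp add: M_def)
  qed
  have main: "\<bar>(\<Sum>n=1..N. (\<Sum>d | d dvd n. moebius_mu d * w (n div d)) / (real n)\<^sup>2)
       - (6 / pi\<^sup>2 * c * ln N + (6 / pi\<^sup>2 * k - c * L))\<bar> \<le> (C + 3 * \<bar>c\<bar> + \<bar>k\<bar>) * (1 + ln N) / N"
    if N: "N \<ge> 1" for N
  proof -
    define R where "R = (\<Sum>d=1..N. moebius_mu d / (real d)\<^sup>2 * (A (N div d) - (c * (ln N - ln d) + k)))"
    define S where "S = (\<Sum>d=1..N. moebius_mu d / (real d)\<^sup>2)"
    define S' where "S' = (\<Sum>d=1..N. moebius_mu d * ln d / (real d)\<^sup>2)"
    have lnN: "ln N \<ge> 0" using N by simp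
    have "(\<Sum>n=1..N. (\<Sum>d | d dvd n. moebius_mu d * w (n div d)) / (real n)\<^sup>2)
       = (\<Sum>n=1..N. \<Sum>d | d dvd n. moebius_mu d / (real d)\<^sup>2 * (w (n div d) / (real (n div d))\<^sup>2))"
      unfolding sum_divide_distrib
      by (intro sum.cong refl) (auto elim!: dvdE simp: power_mult_distrib)
    also have "\<dots> = (\<Sum>d=1..N. moebius_mu d / (real d)\<^sup>2 * A (N div d))"
      unfolding A_def sum_distrib_left by (rule sum_dvd_eq_sum_div)
    also have "\<dots> = R + (c * ln N + k) * S - c * S'"
      unfolding R_def S_def S'_def sum_distrib_left sum.distrib[symmetric] sum_subtractf[symmetric]
      by (rule sum.cong) (simp_all add: field_simps)
    \<comment> \<open>Both truncated series are compared with their limits 6 / pi^2 and L. The first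
      deviation is O(1/N) but is multiplied by c * ln N + k, which still fits the error
      term.\<close>
    finally have "(\<Sum>n=1..N. (\<Sum>d | d dvd n. moebius_mu d * w (n div d)) / (real n)\<^sup>2)
       - (6 / pi\<^sup>2 * c * ln N + (6 / pi\<^sup>2 * k - c * L))
       = R + (c * ln N + k) * (S - 6 / pi\<^sup>2) - c * (S' - L)" (is "?lhs = _")
      by (simp add: algebra_simps add_divide_distrib)
    then have "\<bar>?lhs\<bar> \<le> \<bar>R\<bar> + \<bar>c * ln N + k\<bar> * \<bar>S - 6 / pi\<^sup>2\<bar> + \<bar>c\<bar> * \<bar>S' - L\<bar>"
      unfolding abs_mult[symmetric] by linarith
    also have "\<dots> \<le> C * (1 + ln N) / N + (\<bar>c\<bar> * ln N + \<bar>k\<bar>) * (1 / N) + \<bar>c\<bar> * ((ln N + 2) / N)"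
    proof (intro add_mono mult_mono mult_left_mono)
      show "\<bar>R\<bar> \<le> C * (1 + ln N) / N"
        unfolding R_def by (rule moebius_weighted_error[OF N _ A]) (auto simp: C_def)
      show "\<bar>c * ln N + k\<bar> \<le> \<bar>c\<bar> * ln N + \<bar>k\<bar>"
        using abs_triangle_ineq[of "c * ln N" k] lnN by (simp add: abs_mult)
    qed (use sum_moebius_over_squares_tail[OF N] L[OF N] lnN in \<open>auto simp: S_def S'_def\<close>)
    also have "\<dots> = (C * (1 + ln N) + \<bar>c\<bar> * (2 + 2 * ln N) + \<bar>k\<bar>) / N"
      by (simp add: add_divide_distrib algebra_simps)
    also have "\<dots> \<le> (C + 3 * \<bar>c\<bar> + \<bar>k\<bar>) * (1 + ln N) / N"
    proof (rule divide_right_mono)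
      have "0 \<le> \<bar>c\<bar> * (1 + ln N)" "0 \<le> \<bar>k\<bar> * ln N" using lnN by auto
      then show "C * (1 + ln N) + \<bar>c\<bar> * (2 + 2 * ln N) + \<bar>k\<bar> \<le> (C + 3 * \<bar>c\<bar> + \<bar>k\<bar>) * (1 + ln N)"
        by (simp add: algebra_simps)
    qed simp
    finally show ?thesis .
  qed
  show ?thesis by (rule that[OF main])
qed

section \<open>Counting integers and coprime integers in an interval\<close>

text \<open>Since x is nonnegative, the integers from the ceiling of x to the floor of y transfer
  injectively to \<open>nat\<close>. The truncation by \<open>nat\<close> on the right covers an
  empty interval.\<close>

lemma card_nat_interval:
  fixes x y :: real
  assumes "0 \<le> x"
  shows "card {m::nat. x \<le> m \<and> m \<le> y} = nat (\<lfloor>y\<rfloor> - \<lceil>x\<rceil> + 1)"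
proof -
  have "{m::nat. x \<le> m \<and> m \<le> y} = nat ` {\<lceil>x\<rceil>..\<lfloor>y\<rfloor>}"
  proof (intro equalityI subsetI)
    fix m assume "m \<in> {m::nat. x \<le> m \<and> m \<le> y}"
    then have "int m \<in> {\<lceil>x\<rceil>..\<lfloor>y\<rfloor>}" by (auto simp: le_floor_iff ceiling_le_iff)
    then show "m \<in> nat ` {\<lceil>x\<rceil>..\<lfloor>y\<rfloor>}" by (metis image_eqI nat_int)
  next
    fix m assume "m \<in> nat ` {\<lceil>x\<rceil>..\<lfloor>y\<rfloor>}"
    then obtain i where i: "m = nat i" "\<lceil>x\<rceil> \<le> i" "i \<le> \<lfloor>y\<rfloor>" by auto
    have "i \<ge> 0" using i(2) assms by linarith
    then show "m \<in> {m::nat. x \<le> m \<and> m \<le> y}" using i by (auto simp: le_floor_iff ceiling_le_iff)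
  qed
  moreover have "inj_on nat {\<lceil>x\<rceil>..\<lfloor>y\<rfloor>}"
  proof (rule inj_onI)
    fix i j assume "i \<in> {\<lceil>x\<rceil>..\<lfloor>y\<rfloor>}" "j \<in> {\<lceil>x\<rceil>..\<lfloor>y\<rfloor>}" "nat i = nat j"
    then have "i \<ge> 0" "j \<ge> 0" "nat i = nat j" using assms by (simp_all, linarith+)
    then show "i = j" by (simp add: eq_nat_nat_iff)
  qed
  ultimately show ?thesis by (simp add: card_image)
qed

lemma card_nat_interval_approx:
  fixes x y :: real
  assumes "0 \<le> x" "x \<le> y"
  shows "\<bar>real (card {m::nat. x \<le> m \<and> m \<le> y}) - (y - x)\<bar> \<le> 1"
proof -
  \<comment> \<open>This integer exceeds y - x - 1 \<ge> -1, so the truncation by \<open>nat\<close>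
    has no effect.\<close>
  have "\<lfloor>y\<rfloor> - \<lceil>x\<rceil> + 1 \<ge> 0" using assms by linarith
  then have "real (nat (\<lfloor>y\<rfloor> - \<lceil>x\<rceil> + 1)) = of_int \<lfloor>y\<rfloor> - of_int \<lceil>x\<rceil> + 1" by simp
  then show ?thesis unfolding card_nat_interval[OF assms(1)] by linarith
qed

text \<open>The indicator of coprimality is the sum of mu(d) over d dividing gcd p q. After
  exchanging the sums, the multiples p = d * m in the interval are counted by m in the interval
  scaled down by d.\<close>

lemma card_coprime_eq_sum_moebius:
  fixes x y :: real
  assumes "q > 0"
  shows "real (card {p::nat. coprime p q \<and> x * q \<le> p \<and> p \<le> y * q}) =
    (\<Sum>d | d dvd q. moebius_mu d * card {m::nat. x * real (q div d) \<le> m \<and> m \<le> y * real (q div d)})"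
proof -
  define P where "P = {p::nat. x * q \<le> p \<and> p \<le> y * q}"
  have "P \<subseteq> {..nat \<lfloor>y * q\<rfloor>}" by (auto simp: P_def le_nat_floor)
  then have finP: "finite P" by (rule finite_subset) simp
  have finD: "finite {d. d dvd q}" using assms by simp
  have multiples: "card {p \<in> P. d dvd p} = card {m::nat. x * real (q div d) \<le> m \<and> m \<le> y * real (q div d)}"
    if dq: "d dvd q" for d
  proof -
    obtain k where k: "q = d * k" using dq by (rule dvdE)
    then have d: "d > 0" using assms by (cases d) auto
    have "x * real q \<le> real (d * m) \<longleftrightarrow> x * real (q div d) \<le> real m"
      "real (d * m) \<le> y * real q \<longleftrightarrow> real m \<le> y * real (q div d)" for m
      using d by (simp_all add: k mult.left_commute[of _ "real d"])
    then have "{p \<in> P. d dvd p} = (\<lambda>m. d * m) ` {m::nat. x * real (q div d) \<le> m \<and> m \<le> y * real (q div d)}"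
      unfolding P_def dvd_def by blast
    moreover have "inj_on (\<lambda>m. d * m) A" for A using d by (auto simp: inj_on_def)
    ultimately show ?thesis by (simp add: card_image)
  qed
  have "real (card {p::nat. coprime p q \<and> x * q \<le> p \<and> p \<le> y * q}) = (\<Sum>p\<in>P. if gcd p q = 1 then 1 else 0)"
  proof -
    have "{p::nat. coprime p q \<and> x * q \<le> p \<and> p \<le> y * q} = {p \<in> P. gcd p q = 1}"
      by (auto simp: P_def coprime_iff_gcd_eq_1)
    then show ?thesis using finP by (simp add: sum.inter_filter[symmetric])
  qed
  also have "\<dots> = (\<Sum>p\<in>P. \<Sum>d | d dvd gcd p q. moebius_mu d)"
    using assms by (intro sum.cong refl, subst sum_moebius_dvd) auto
  also have "\<dots> = (\<Sum>p\<in>P. \<Sum>d | d dvd q. if d dvd p then moebius_mu d else 0)"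
  proof (rule sum.cong[OF refl])
    fix p
    have "{d. d dvd gcd p q} = {d \<in> {d. d dvd q}. d dvd p}" by auto
    then show "(\<Sum>d | d dvd gcd p q. moebius_mu d) = (\<Sum>d | d dvd q. if d dvd p then moebius_mu d else 0)"
      using sum.inter_filter[OF finD, of moebius_mu "\<lambda>d. d dvd p"] by simp
  qed
  also have "\<dots> = (\<Sum>d | d dvd q. \<Sum>p\<in>P. if d dvd p then moebius_mu d else 0)"
    by (rule sum.swap)
  also have "\<dots> = (\<Sum>d | d dvd q. moebius_mu d * card {p \<in> P. d dvd p})"
    using finP by (intro sum.cong refl) (simp add: sum.inter_filter[symmetric])
  also have "\<dots> = (\<Sum>d | d dvd q. moebius_mu d * card {m::nat. x * real (q div d) \<le> m \<and> m \<le> y * real (q div d)})"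
    by (intro sum.cong refl) (simp add: multiples)
  finally show ?thesis .
qed

section \<open>Farey fractions grouped by denominator\<close>

lemma denom_of_nat_fraction:
  assumes "coprime p q" "q > 0"
  shows "snd (quotient_of (of_nat p / of_nat q)) = int q"
proof -
  have "quotient_of (Fract (int p) (int q)) = (int p, int q)"
    using assms by (simp add: quotient_of_Fract normalize_stable)
  then show ?thesis by (simp add: Fract_of_int_quotient)
qed

text \<open>The denominator comes first in the pairs so that sums split with q outermost. The bound
  \<beta> \<le> 1 supplies p \<le> q.\<close>

lemma farey_in_eq_image:
  fixes \<alpha> \<beta> :: real
  assumes "0 \<le> \<alpha>" "\<beta> \<le> 1"
  shows "farey_in \<alpha> \<beta> Q = (\<lambda>(q, p). of_nat p / of_nat q) `
    (SIGMA q:{1..Q}. {p::nat. coprime p q \<and> \<alpha> * q \<le> p \<and> p \<le> \<beta> * q})"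
proof (intro equalityI subsetI)
  fix r assume "r \<in> farey_in \<alpha> \<beta> Q"
  then obtain p q :: nat where r: "r = of_nat p / of_nat q" "q \<le> Q" "1 \<le> q" "coprime p q"
    "of_rat r \<in> {\<alpha>..\<beta>}"
    unfolding farey_in_def farey_def by blast
  moreover have "(of_rat r :: real) = p / q" by (simp add: r(1) of_rat_divide)
  ultimately have "\<alpha> \<le> p / q" "p / q \<le> \<beta>" by simp_all
  then have "(q, p) \<in> (SIGMA q:{1..Q}. {p::nat. coprime p q \<and> \<alpha> * q \<le> p \<and> p \<le> \<beta> * q})"
    using r(2-4) by (simp add: field_simps)
  then show "r \<in> (\<lambda>(q, p). of_nat p / of_nat q) `
    (SIGMA q:{1..Q}. {p::nat. coprime p q \<and> \<alpha> * q \<le> p \<and> p \<le> \<beta> * q})"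
    using r(1) by (rule_tac image_eqI) auto
next
  fix r :: rat assume "r \<in> (\<lambda>(q, p). of_nat p / of_nat q) `
    (SIGMA q:{1..Q}. {p::nat. coprime p q \<and> \<alpha> * q \<le> p \<and> p \<le> \<beta> * q})"
  then obtain p q :: nat where r: "r = of_nat p / of_nat q" "1 \<le> q" "q \<le> Q" "coprime p q"
    "\<alpha> * q \<le> p" "p \<le> \<beta> * q" by auto
  have "real p \<le> real q" using r(6) assms(2) mult_right_mono[of \<beta> 1 "real q"] by simp
  then have "r \<in> farey Q"
    unfolding farey_def mem_Collect_eq using r by (intro exI[of _ p] exI[of _ q]) simp
  moreover have "(of_rat r :: real) = p / q" by (simp add: r(1) of_rat_divide)
  moreover have "\<alpha> \<le> p / q" "p / q \<le> \<beta>" using r(2,5,6) by (simp_all add: field_simps)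
  ultimately show "r \<in> farey_in \<alpha> \<beta> Q" by (simp add: farey_in_def)
qed

lemma finite_coprime_interval:
  "finite {p::nat. coprime p q \<and> x \<le> real p \<and> real p \<le> y}"
proof (rule finite_subset)
  show "{p::nat. coprime p q \<and> x \<le> real p \<and> real p \<le> y} \<subseteq> {..nat \<lfloor>y\<rfloor>}" by (auto simp: le_nat_floor)
qed simp

lemma finite_farey_in:
  fixes \<alpha> \<beta> :: real
  assumes "0 \<le> \<alpha>" "\<beta> \<le> 1"
  shows "finite (farey_in \<alpha> \<beta> Q)"
  unfolding farey_in_eq_image[OF assms]
  by (intro finite_imageI finite_SigmaI finite_coprime_interval) auto

text \<open>Lowest terms make the parametrisation by pairs injective, and the summand depends on q
  alone, so each q is weighted by its number of numerators.\<close>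

lemma sum_denom_farey_in:
  fixes \<alpha> \<beta> :: real and h :: "int \<Rightarrow> real"
  assumes "0 \<le> \<alpha>" "\<beta> \<le> 1"
  shows "(\<Sum>r\<in>farey_in \<alpha> \<beta> Q. h (snd (quotient_of r))) =
    (\<Sum>q=1..Q. real (card {p::nat. coprime p q \<and> \<alpha> * q \<le> p \<and> p \<le> \<beta> * q}) * h (int q))"
proof -
  let ?S = "SIGMA q:{1..Q}. {p::nat. coprime p q \<and> \<alpha> * q \<le> p \<and> p \<le> \<beta> * q}"
  have den: "snd (quotient_of (of_nat p / of_nat q)) = int q" if "(q, p) \<in> ?S" for p q
    using that by (intro denom_of_nat_fraction) auto
  have inj: "inj_on (\<lambda>(q, p). of_nat p / of_nat q :: rat) ?S"
  proof (rule inj_onI)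
    fix z z' assume z: "z \<in> ?S" "z' \<in> ?S"
      and eq: "(case z of (q, p) \<Rightarrow> (of_nat p / of_nat q :: rat)) = (case z' of (q, p) \<Rightarrow> of_nat p / of_nat q)"
    obtain q p q' p' where qp: "z = (q, p)" "z' = (q', p')" by fastforce
    then have q: "q = q'" using den[of q p] den[of q' p'] z eq by simp
    moreover have "q > 0" using z(1) qp(1) by auto
    ultimately show "z = z'" using eq qp by simp
  qed
  have "(\<Sum>r\<in>farey_in \<alpha> \<beta> Q. h (snd (quotient_of r))) = (\<Sum>(q, p)\<in>?S. h (int q))"
    unfolding farey_in_eq_image[OF assms] sum.reindex[OF inj]
    by (rule sum.cong) (auto simp: denom_of_nat_fraction)
  also have "\<dots> = (\<Sum>q=1..Q. \<Sum>p | coprime p q \<and> \<alpha> * q \<le> real p \<and> real p \<le> \<beta> * q. h (int q))"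
    by (rule sum.Sigma[symmetric]) (auto intro: finite_coprime_interval)
  finally show ?thesis by simp
qed

section \<open>Reducing the moment to a sum over denominators\<close>

text \<open>Every entry lies in two consecutive pairs, except that the first and the last each miss
  one.\<close>

lemma sum_consecutive_pairs:
  fixes f :: "'a \<Rightarrow> real"
  assumes "xs \<noteq> []"
  shows "(\<Sum>j=1..length xs - 1. f (xs ! (j - 1)) + f (xs ! j)) =
    2 * (\<Sum>x\<leftarrow>xs. f x) - f (hd xs) - f (last xs)"
  using assms
proof (induction xs rule: rev_nonempty_induct)
  case (snoc x xs)
  have "(\<Sum>j=1..length xs. f ((xs @ [x]) ! (j - 1)) + f ((xs @ [x]) ! j)) =
      (\<Sum>j=1..length xs - 1. f ((xs @ [x]) ! (j - 1)) + f ((xs @ [x]) ! j)) + (f (last xs) + f x)"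
    using snoc(1) by (cases xs rule: rev_cases) (auto simp: nth_append)
  also have "(\<Sum>j=1..length xs - 1. f ((xs @ [x]) ! (j - 1)) + f ((xs @ [x]) ! j)) =
      (\<Sum>j=1..length xs - 1. f (xs ! (j - 1)) + f (xs ! j))"
  proof (intro sum.cong refl)
    fix j assume "j \<in> {1..length xs - 1}"
    then have "j < length xs" "j - 1 < length xs" by auto
    then show "f ((xs @ [x]) ! (j - 1)) + f ((xs @ [x]) ! j) = f (xs ! (j - 1)) + f (xs ! j)"
      by (simp add: nth_append)
  qed
  finally show ?case using snoc by simp
qed simp

text \<open>Used for the endpoints of the interval: once Q reaches their denominators they are
  themselves the extreme fractions.\<close>

lemma farey_in_rational_endpoint:
  fixes x :: rat
  assumes "0 \<le> x" "x \<le> 1" "of_rat x \<in> {\<alpha>..\<beta>}"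
    and "snd (quotient_of x) \<le> int Q"
  shows "x \<in> farey_in \<alpha> \<beta> Q"
proof -
  obtain a b where ab: "quotient_of x = (a, b)" by fastforce
  have b: "b > 0" using quotient_of_denom_pos[OF ab] .
  have x: "x = of_int a / of_int b" using quotient_of_div[OF ab] .
  have cop: "coprime a b" using quotient_of_coprime[OF ab] .
  have a: "a \<ge> 0" using assms(1) b by (simp add: x zero_le_divide_iff)
  have "a \<le> b" using assms(2) b by (simp add: x)
  moreover have "x = of_nat (nat a) / of_nat (nat b)" using a b by (simp add: x)
  moreover have "coprime (nat a) (nat b)" using cop a b by (simp add: coprime_int_iff[symmetric])
  ultimately have "x \<in> farey Q"
    unfolding farey_def mem_Collect_eq using a b assms(4) ab
    by (intro exI[of _ "nat a"] exI[of _ "nat b"]) (simp add: nat_le_iff Suc_le_eq)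
  then show ?thesis using assms(3) by (simp add: farey_in_def)
qed

lemma hd_sorted_list_of_set:
  assumes "finite A" "A \<noteq> {}" shows "hd (sorted_list_of_set A) = Min A"
  using assms by (simp add: sorted_list_of_set_nonempty)

lemma last_sorted_list_of_set:
  assumes "finite A" "A \<noteq> {}" shows "last (sorted_list_of_set A) = Max A"
proof (rule Max_eqI[symmetric])
  have ne: "sorted_list_of_set A \<noteq> []" using assms by simp
  then show "last (sorted_list_of_set A) \<in> A" using last_in_set[OF ne] assms(1) by simp
  fix y assume "y \<in> A"
  then obtain i where i: "i < length (sorted_list_of_set A)" "y = sorted_list_of_set A ! i"
    using assms by (metis in_set_conv_nth set_sorted_list_of_set)
  then show "y \<le> last (sorted_list_of_set A)"
    unfolding last_conv_nth[OF ne] i(2) by (intro sorted_nth_mono) auto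
qed (fact assms)

text \<open>At (q / Q, q' / Q) the function equals Q^2 / 2 * (1 / q^2 + 1 / q'^2), so the moment is
  a sum over consecutive pairs whose boundary terms belong to x and y.\<close>

lemma moment_eq_sum_inverse_squares:
  fixes x y :: rat
  assumes "0 \<le> x" "x < y" "y \<le> 1"
    and Q: "Q = farey_order \<delta>" "snd (quotient_of x) \<le> int Q" "snd (quotient_of y) \<le> int Q"
  shows "moment (\<lambda>(u, v). 1 / (2 * u^2) + 1 / (2 * v^2)) (of_rat x) (of_rat y) \<delta> =
    (real Q)\<^sup>2 / (of_rat y - of_rat x) *
      ((\<Sum>q=1..Q. real (card {p::nat. coprime p q \<and> of_rat x * q \<le> real p \<and> p \<le> of_rat y * real q}) / (real q)\<^sup>2)
       - (1 / (of_int (snd (quotient_of x)))\<^sup>2 + 1 / (of_int (snd (quotient_of y)))\<^sup>2) / 2)"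
proof -
  define \<alpha> \<beta> :: real where "\<alpha> = of_rat x" and "\<beta> = of_rat y"
  have \<alpha>\<beta>: "0 \<le> \<alpha>" "\<alpha> < \<beta>" "\<beta> \<le> 1" using assms by (auto simp: \<alpha>_def \<beta>_def of_rat_less)
  define S where "S = farey_in \<alpha> \<beta> Q"
  define xs where "xs = sorted_list_of_set S"
  define f :: "rat \<Rightarrow> real" where "f r = 1 / (of_int (snd (quotient_of r)))\<^sup>2" for r
  have finS: "finite S" unfolding S_def by (rule finite_farey_in) (use \<alpha>\<beta> in auto)
  have xS: "x \<in> S" unfolding S_def
    by (rule farey_in_rational_endpoint) (use assms \<alpha>\<beta> in \<open>auto simp: \<alpha>_def \<beta>_def\<close>)
  have yS: "y \<in> S" unfolding S_def
    by (rule farey_in_rational_endpoint) (use assms \<alpha>\<beta> in \<open>auto simp: \<alpha>_def \<beta>_def\<close>)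
  have bounds: "x \<le> r \<and> r \<le> y" if "r \<in> S" for r
    using that by (auto simp: S_def farey_in_def \<alpha>_def \<beta>_def of_rat_less_eq)
  have ne: "S \<noteq> {}" "xs \<noteq> []" using xS finS by (auto simp: xs_def)
  have hd: "hd xs = x" unfolding xs_def hd_sorted_list_of_set[OF finS ne(1)]
    by (rule Min_eqI) (use finS xS bounds in auto)
  have last: "last xs = y" unfolding xs_def last_sorted_list_of_set[OF finS ne(1)]
    by (rule Max_eqI) (use finS yS bounds in auto)
  have len: "farey_count \<alpha> \<beta> Q = length xs"
    by (simp add: farey_count_def xs_def S_def[symmetric])
  \<comment> \<open>The function is nonnegative, so the absolute value drops. Fractions are counted
    from 1 but list positions from 0, hence \<open>j - 1\<close> and \<open>j\<close>.\<close>
  have "moment (\<lambda>(u, v). 1 / (2 * u^2) + 1 / (2 * v^2)) \<alpha> \<beta> \<delta> =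
      1 / (\<beta> - \<alpha>) * (\<Sum>j=1..length xs - 1. (real Q)\<^sup>2 / 2 * (f (xs ! (j - 1)) + f (xs ! j)))"
    unfolding moment_def Q(1)[symmetric] Let_def len
    by (intro arg_cong[where f = "\<lambda>z. 1 / (\<beta> - \<alpha>) * z"] sum.cong refl)
      (simp add: farey_denom_def S_def[symmetric] xs_def[symmetric] f_def power_divide field_simps)
  also have "\<dots> = 1 / (\<beta> - \<alpha>) * ((real Q)\<^sup>2 / 2 * (2 * (\<Sum>r\<leftarrow>xs. f r) - f x - f y))"
    unfolding sum_distrib_left[symmetric] sum_consecutive_pairs[OF ne(2)] hd last ..
  also have "(\<Sum>r\<leftarrow>xs. f r) = (\<Sum>r\<in>S. f r)"
    using finS by (simp add: xs_def sum_list_distinct_conv_sum_set)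
  also have "(\<Sum>r\<in>S. f r) = (\<Sum>q=1..Q. real (card {p::nat. coprime p q \<and> \<alpha> * q \<le> p \<and> p \<le> \<beta> * q}) / (real q)\<^sup>2)"
    unfolding S_def f_def using sum_denom_farey_in[of \<alpha> \<beta> "\<lambda>q. 1 / (of_int q)\<^sup>2" Q] \<alpha>\<beta> by simp
  finally show ?thesis by (simp add: \<alpha>_def \<beta>_def f_def field_simps)
qed

section \<open>The limit \<delta> to 0 and the conclusion\<close>

lemma filterlim_farey_order: "filterlim farey_order at_top (at_right 0)"
  unfolding farey_order_def
proof (rule filterlim_compose[OF filterlim_nat_sequentially filterlim_compose[OF filterlim_floor_sequentially]])
  show "filterlim (\<lambda>\<delta>::real. 1 / sqrt (2 * \<delta>)) at_top (at_right 0)"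
    by real_asymp
qed

theorem theorem1p1:
  fixes \<alpha> \<beta> :: real and F :: "real \<times> real \<Rightarrow> real"
  assumes "0 \<le> \<alpha>" and "\<alpha> < \<beta>" and "\<beta> \<le> 1"
    and "\<alpha> \<in> \<rat>" and "\<beta> \<in> \<rat>"
  defines "F \<equiv> \<lambda>(x, y). 1 / (2 * x^2) + 1 / (2 * y^2)"
  shows "\<exists>D :: real.
    (\<lambda>\<delta>. moment F \<alpha> \<beta> \<delta>
          - (6 / pi^2 * (real (farey_order \<delta>))^2 * ln (real (farey_order \<delta>))
             + D * (real (farey_order \<delta>))^2))
      \<in> O[at_right 0](\<lambda>\<delta>. real (farey_order \<delta>) * ln (real (farey_order \<delta>)))"
proof -
  obtain x y where xy: "\<alpha> = of_rat x" "\<beta> = of_rat y" using assms(4,5) by (auto elim!: Rats_cases)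
  have xy': "0 \<le> x" "x < y" "y \<le> 1" using assms(1-3) by (auto simp: xy of_rat_less)
  define c where "c = \<beta> - \<alpha>"
  have c: "c > 0" using assms(2) by (simp add: c_def)
  define w where "w e = real (card {m::nat. \<alpha> * real e \<le> m \<and> m \<le> \<beta> * real e})" for e :: nat
  define T where "T Q = (\<Sum>q=1..Q. real (card {p::nat. coprime p q \<and> \<alpha> * q \<le> p \<and> p \<le> \<beta> * q}) / (real q)\<^sup>2)" for Q :: nat
  define E where "E = (1 / (of_int (snd (quotient_of x)))\<^sup>2 + 1 / (of_int (snd (quotient_of y)))\<^sup>2) / (2 :: real)"
  have w: "\<bar>w e - c * real e\<bar> \<le> 1" for e
    unfolding w_def c_def left_diff_distrib
    by (rule card_nat_interval_approx) (use assms(1,2) in \<open>auto intro: mult_right_mono\<close>)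
  obtain K C where KC: "\<And>N. N \<ge> 1 \<Longrightarrow>
      \<bar>(\<Sum>n=1..N. (\<Sum>d | d dvd n. moebius_mu d * w (n div d)) / (real n)\<^sup>2)
        - (6 / pi\<^sup>2 * c * ln N + K)\<bar> \<le> C * (1 + ln N) / N"
    using moebius_convolution_asymptotic[OF w] by blast
  have T: "\<bar>T N - (6 / pi\<^sup>2 * c * ln N + K)\<bar> \<le> C * (1 + ln N) / N" if N: "N \<ge> 1" for N
  proof -
    have "T N = (\<Sum>n=1..N. (\<Sum>d | d dvd n. moebius_mu d * w (n div d)) / (real n)\<^sup>2)"
      unfolding T_def w_def
      by (intro sum.cong refl, subst card_coprime_eq_sum_moebius) auto
    then show ?thesis using KC[OF N] by simp
  qed
  \<comment> \<open>The moment is Q^2 / c * (T Q - E): dividing by c reduces the leading coefficient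
    to 6 / pi^2 and turns the constant K - E into D.\<close>
  define D where "D = (K - E) / c"
  \<comment> \<open>The 3 exceeds e, so that ln Q \<ge> 1 and 1 + ln Q \<le> 2 * ln Q; the
    denominators ensure that both endpoints occur among the fractions.\<close>
  define Q0 where "Q0 = max 3 (max (nat (snd (quotient_of x))) (nat (snd (quotient_of y))))"
  have bound: "\<bar>moment F \<alpha> \<beta> \<delta> - (6 / pi\<^sup>2 * (real Q)\<^sup>2 * ln Q + D * (real Q)\<^sup>2)\<bar>
      \<le> 2 * \<bar>C\<bar> / c * \<bar>real Q * ln Q\<bar>"
    if Q: "Q = farey_order \<delta>" "Q \<ge> Q0" for Q \<delta>
  proof -
    have Q3: "Q \<ge> 3" and den: "snd (quotient_of x) \<le> int Q" "snd (quotient_of y) \<le> int Q"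
      using Q(2) by (auto simp: Q0_def)
    have "ln (exp 1) \<le> ln (real Q)" using Q3 exp_le by (subst ln_le_cancel_iff) auto
    then have ln1: "ln Q \<ge> 1" by simp
    have "moment F \<alpha> \<beta> \<delta> = (real Q)\<^sup>2 / c * (T Q - E)"
      unfolding F_def xy c_def T_def E_def by (rule moment_eq_sum_inverse_squares[OF xy' Q(1) den])
    then have "moment F \<alpha> \<beta> \<delta> - (6 / pi\<^sup>2 * (real Q)\<^sup>2 * ln Q + D * (real Q)\<^sup>2)
        = (real Q)\<^sup>2 * ((T Q - E) / c - (6 / pi\<^sup>2 * ln Q + D))"
      by (simp add: algebra_simps)
    also have "(T Q - E) / c - (6 / pi\<^sup>2 * ln Q + D) = (T Q - (6 / pi\<^sup>2 * c * ln Q + K)) / c"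
      using c by (simp add: D_def diff_divide_distrib add_divide_distrib)
    also have "\<bar>(real Q)\<^sup>2 * \<dots>\<bar> = (real Q)\<^sup>2 / c * \<bar>T Q - (6 / pi\<^sup>2 * c * ln Q + K)\<bar>"
      using c by (simp add: abs_mult)
    also have "\<dots> \<le> (real Q)\<^sup>2 / c * (C * (1 + ln Q) / Q)"
      using c Q3 by (intro mult_left_mono T) auto
    also have "\<dots> = real Q / c * (C * (1 + ln Q))"
      using Q3 by (simp add: power2_eq_square)
    \<comment> \<open>The sign of C is unspecified, hence its absolute value.\<close>
    also have "\<dots> \<le> real Q / c * (\<bar>C\<bar> * (2 * ln Q))"
      using c ln1 by (intro mult_left_mono mult_mono) auto
    also have "\<dots> = 2 * \<bar>C\<bar> / c * \<bar>real Q * ln Q\<bar>" using ln1 by simp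
    finally show ?thesis .
  qed
  have "\<forall>\<^sub>F \<delta> in at_right 0. farey_order \<delta> \<ge> Q0"
    using filterlim_farey_order by (simp add: filterlim_at_top)
  then have "(\<lambda>\<delta>. moment F \<alpha> \<beta> \<delta> - (6 / pi^2 * (real (farey_order \<delta>))^2 * ln (real (farey_order \<delta>))
             + D * (real (farey_order \<delta>))^2))
      \<in> O[at_right 0](\<lambda>\<delta>. real (farey_order \<delta>) * ln (real (farey_order \<delta>)))"
    by (intro bigoI[of _ "2 * \<bar>C\<bar> / c"]) (auto elim!: eventually_mono dest: bound[OF refl])
  then show ?thesis by blast
qed

end
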